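(* Let $A_1,\dots,A_M\in\mathbb{R}^{n\times n}$, $\mathcal{M}=\{1,\dots,M\}$ and $A(w)=\sum_{i\in\mathcal{M}}w_iA_i$ for $w\in\mathcal{W}$. If the difference inclusion $x(k+1)=A(w(k))x(k)$ (resp. the differential inclusion $\dot x(t)=A(w(t))x(t)$) is weakly convergent, then it admits a weak convex Lyapunov function.
   Context: $\mathcal{W}=\{w\in\mathbb{R}^M:\ \sum_{i\in\mathcal{M}}w_i=1,\ w_i\ge0\ \forall i\in\mathcal{M}\}$. The inclusion is weakly convergent if for every sequence $w(k)\in\mathcal{W}$, $k\in\mathbb{N}$ (resp. every measurable function $w(t)\in\mathcal{W}$, $t\ge0$) and every $x(0)\in\mathbb{R}^n$ there exists $\bar x\in\mathbb{R}^n$ such that the solution converges to $\bar x$ as time tends to infinity. A weak Lyapunov function is a positive definite function $V:\mathbb{R}^n\to\mathbb{R}_{\ge0}$ such that, for all $x\in\mathbb{R}^n$ and $w\in\mathcal{W}$, $V(A(w)x)\le V(x)$ in discrete time, and $\limsup_{h\to0^+}\frac{V(x+hA(w)x)-V(x)}{h}\le0$ in continuous time. It is a weak convex Lyapunov function if moreover $V$ is convex. *)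

theory Defs
  imports "HOL-Analysis.Analysis"
begin

text \<open>
  The modes are indexed by a finite type \<open>'m\<close> and the state space is \<open>real ^ 'n\<close>; since types are
  nonempty, both the number of modes and the dimension are at least one.
\<close>

definition weight_simplex :: "(real ^ 'm) set" where
  "weight_simplex = {w. (\<Sum>i\<in>UNIV. w $ i) = 1 \<and> (\<forall>i. 0 \<le> w $ i)}"

definition mixture :: "('m::finite \<Rightarrow> real ^ 'n ^ 'n) \<Rightarrow> real ^ 'm \<Rightarrow> real ^ 'n ^ 'n" where
  "mixture A w = (\<Sum>i\<in>UNIV. w $ i *\<^sub>R A i)"

definition discrete_solution ::
    "('m::finite \<Rightarrow> real ^ 'n ^ 'n) \<Rightarrow> (nat \<Rightarrow> real ^ 'm) \<Rightarrow> (nat \<Rightarrow> real ^ 'n) \<Rightarrow> bool" where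
  "discrete_solution A w x \<longleftrightarrow> (\<forall>k. x (Suc k) = mixture A (w k) *v x k)"

text \<open>
  The usual epsilon-delta definition: \<open>D\<close> ranges over the finite families of nonoverlapping
  compact subintervals of \<open>{a..b}\<close>. Such a family is a division of its own union, and \<open>Inf K\<close>
  and \<open>Sup K\<close> are the end points of a member \<open>K\<close>.
\<close>

definition absolutely_continuous_fun ::
    "real \<Rightarrow> real \<Rightarrow> (real \<Rightarrow> 'a::real_normed_vector) \<Rightarrow> bool" where
  "absolutely_continuous_fun a b f \<longleftrightarrow>
    (\<forall>\<epsilon>>0. \<exists>\<delta>>0. \<forall>D. D division_of \<Union>D \<longrightarrow> \<Union>D \<subseteq> {a..b} \<longrightarrow>
      (\<Sum>K\<in>D. Sup K - Inf K) < \<delta> \<longrightarrow> (\<Sum>K\<in>D. norm (f (Sup K) - f (Inf K))) < \<epsilon>)"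

text \<open>
  Solutions are in the sense of Caratheodory: locally absolutely continuous on \<open>{0..}\<close> and
  satisfying the differential equation at almost every \<open>t \<ge> 0\<close>. The values of \<open>w\<close> and \<open>x\<close> at
  negative times are irrelevant.
\<close>

definition continuous_solution ::
    "('m::finite \<Rightarrow> real ^ 'n ^ 'n) \<Rightarrow> (real \<Rightarrow> real ^ 'm) \<Rightarrow> (real \<Rightarrow> real ^ 'n) \<Rightarrow> bool" where
  "continuous_solution A w x \<longleftrightarrow>
    (\<forall>T\<ge>0. absolutely_continuous_fun 0 T x) \<and>
    (AE t in lebesgue_on {0..}.
      (x has_vector_derivative (mixture A (w t) *v x t)) (at t within {0..}))"

text \<open>
  For given \<open>w\<close> and initial state the solution on \<open>{0..}\<close> exists and is unique (\<open>w\<close> is bounded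
  and measurable, the right-hand side is linear in the state), so quantifying over all solutions
  amounts to speaking of the solution.
\<close>

definition weakly_convergent_discrete :: "('m::finite \<Rightarrow> real ^ 'n ^ 'n) \<Rightarrow> bool" where
  "weakly_convergent_discrete A \<longleftrightarrow>
    (\<forall>w x0. (\<forall>k. w k \<in> weight_simplex) \<longrightarrow>
      (\<exists>xbar. \<forall>x. discrete_solution A w x \<and> x 0 = x0 \<longrightarrow> x \<longlonglongrightarrow> xbar))"

definition weakly_convergent_continuous :: "('m::finite \<Rightarrow> real ^ 'n ^ 'n) \<Rightarrow> bool" where
  "weakly_convergent_continuous A \<longleftrightarrow>
    (\<forall>w x0. w \<in> borel_measurable (lebesgue_on {0..}) \<and> (\<forall>t\<ge>0. w t \<in> weight_simplex) \<longrightarrow>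
      (\<exists>xbar. \<forall>x. continuous_solution A w x \<and> x 0 = x0 \<longrightarrow> (x \<longlongrightarrow> xbar) at_top))"

definition positive_definite_fun :: "('a::zero \<Rightarrow> real) \<Rightarrow> bool" where
  "positive_definite_fun V \<longleftrightarrow> V 0 = 0 \<and> (\<forall>x. x \<noteq> 0 \<longrightarrow> 0 < V x)"

definition weak_Lyapunov_discrete ::
    "('m::finite \<Rightarrow> real ^ 'n ^ 'n) \<Rightarrow> (real ^ 'n \<Rightarrow> real) \<Rightarrow> bool" where
  "weak_Lyapunov_discrete A V \<longleftrightarrow> positive_definite_fun V \<and>
    (\<forall>x. \<forall>w\<in>weight_simplex. V (mixture A w *v x) \<le> V x)"

text \<open>The upper limit is taken in the extended reals, so that it always exists.\<close>

definition weak_Lyapunov_continuous ::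
    "('m::finite \<Rightarrow> real ^ 'n ^ 'n) \<Rightarrow> (real ^ 'n \<Rightarrow> real) \<Rightarrow> bool" where
  "weak_Lyapunov_continuous A V \<longleftrightarrow> positive_definite_fun V \<and>
    (\<forall>x. \<forall>w\<in>weight_simplex.
      Limsup (at_right 0) (\<lambda>h. ereal ((V (x + h *\<^sub>R (mixture A w *v x)) - V x) / h)) \<le> 0)"

definition weak_convex_Lyapunov_discrete ::
    "('m::finite \<Rightarrow> real ^ 'n ^ 'n) \<Rightarrow> (real ^ 'n \<Rightarrow> real) \<Rightarrow> bool" where
  "weak_convex_Lyapunov_discrete A V \<longleftrightarrow> weak_Lyapunov_discrete A V \<and> convex_on UNIV V"

definition weak_convex_Lyapunov_continuous ::
    "('m::finite \<Rightarrow> real ^ 'n ^ 'n) \<Rightarrow> (real ^ 'n \<Rightarrow> real) \<Rightarrow> bool" where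
  "weak_convex_Lyapunov_continuous A V \<longleftrightarrow> weak_Lyapunov_continuous A V \<and> convex_on UNIV V"

end

theory Submission
  imports Defs
begin

text \<open>
  Both inclusions are instances of the same object: a bounded family \<open>\<F>\<close> of linear maps that may
  be applied one after the other in any order. In discrete time \<open>\<F>\<close> consists of the maps
  \<open>A(w)\<close>; in continuous time it consists of the flows \<open>exp (t A(w))\<close> with \<open>0 < t \<le> 1\<close>. The
  candidate function is \<open>V x = sup \<parallel>P x\<parallel>\<close> over all finite products \<open>P\<close> of members of \<open>\<F>\<close>,
  called \<open>orbit_norm\<close> below. If it is finite everywhere, it is a norm, hence convex and
  positive definite, and it cannot increase under a member of \<open>\<F>\<close>, because following \<open>F\<close> by a
  product gives again a product.

  All the work is therefore in the finiteness of \<open>V\<close>, a uniform boundedness principle for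
  switching: convergence makes each single trajectory bounded, but says nothing about all of them
  together. Let \<open>B\<close> be the set of points where \<open>V\<close> is finite. It is an invariant subspace,
  and since it has a finite basis, \<open>V\<close> is bounded by a multiple of the norm on it. Starting
  at a point outside \<open>B\<close>, a trajectory that enters \<open>B\<close> can from then on grow only by a constant
  factor; so arbitrarily large values must already be reached outside \<open>B\<close>
  (\<open>escape_outside_bounded_orbit\<close>). From such a large point outside \<open>B\<close> the argument can be
  repeated, and concatenating the finite products so obtained gives one infinite switching sequence
  with an unbounded trajectory (\<open>unbounded_trajectory\<close>), which contradicts convergence.

  In continuous time two more things are needed. The unbounded sequence has to be turned into a
  Caratheodory solution for a measurable piecewise constant \<open>w\<close> (\<open>piecewise_flow_solution\<close>); its
  switching times tend to infinity, since growth is at most exponential in time. And the decrease of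
  \<open>V\<close> along the flows has to be turned into a statement about \<open>x + h A(w) x\<close>, which differs
  from \<open>exp (h A(w)) x\<close> by \<open>o(h)\<close>, and \<open>V\<close> is bounded by a multiple of the norm
  (\<open>Limsup_orbit_norm_le_0\<close>).
\<close>

section \<open>Switching between linear maps\<close>

definition run :: "('a \<Rightarrow> 'a) list \<Rightarrow> 'a \<Rightarrow> 'a" where
  "run p = fold id p"

lemma run_simps [simp]:
  "run [] x = x" "run (F # p) x = run p (F x)" "run (p @ q) x = run q (run p x)"
  by (auto simp: run_def)

lemma linear_run:
  assumes "\<And>F. F \<in> \<F> \<Longrightarrow> linear F" "p \<in> lists \<F>"
  shows "linear (run p)"
  using assms(2)
proof induction
  case Nil
  have "run [] = (id :: 'a \<Rightarrow> 'a)" by auto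
  then show ?case by (metis linear_id)
next
  case (Cons F p)
  have "run (F # p) = run p \<circ> F" by auto
  then show ?case using Cons assms(1) by (metis linear_compose)
qed

definition bounded_orbit :: "('a \<Rightarrow> 'a::real_normed_vector) set \<Rightarrow> 'a set" where
  "bounded_orbit \<F> = {x. \<exists>M. \<forall>p\<in>lists \<F>. norm (run p x) \<le> M}"

lemma subspace_bounded_orbit:
  assumes lin: "\<And>F. F \<in> \<F> \<Longrightarrow> linear F"
  shows "subspace (bounded_orbit \<F>)"
  unfolding subspace_def
proof (intro conjI ballI allI)
  have r: "linear (run p)" if "p \<in> lists \<F>" for p
    using linear_run[of \<F>] lin that by blast
  show "0 \<in> bounded_orbit \<F>"
    unfolding bounded_orbit_def using linear_0[OF r] by (auto intro!: exI[of _ 0])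
  fix x assume "x \<in> bounded_orbit \<F>"
  then obtain M where M: "\<And>p. p \<in> lists \<F> \<Longrightarrow> norm (run p x) \<le> M"
    unfolding bounded_orbit_def by blast
  {
    fix y assume "y \<in> bounded_orbit \<F>"
    then obtain N where N: "\<And>p. p \<in> lists \<F> \<Longrightarrow> norm (run p y) \<le> N"
      unfolding bounded_orbit_def by blast
    have "norm (run p (x + y)) \<le> M + N" if "p \<in> lists \<F>" for p
      using norm_triangle_mono[OF M[OF that] N[OF that]] linear_add[OF r[OF that]] by simp
    then show "x + y \<in> bounded_orbit \<F>"
      unfolding bounded_orbit_def by blast
  next
    fix c :: real
    have "norm (run p (c *\<^sub>R x)) \<le> \<bar>c\<bar> * M" if "p \<in> lists \<F>" for p
      using M[OF that] linear_scale[OF r[OF that]] by (simp add: mult_left_mono)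
    then show "c *\<^sub>R x \<in> bounded_orbit \<F>"
      unfolding bounded_orbit_def by blast
  }
qed

lemma bounded_orbit_step:
  assumes "F \<in> \<F>" "x \<in> bounded_orbit \<F>"
  shows "F x \<in> bounded_orbit \<F>"
proof -
  obtain M where M: "\<And>p. p \<in> lists \<F> \<Longrightarrow> norm (run p x) \<le> M"
    using assms(2) unfolding bounded_orbit_def by blast
  have "norm (run p (F x)) \<le> M" if "p \<in> lists \<F>" for p
    using M[of "F # p"] that assms(1) by simp
  then show ?thesis unfolding bounded_orbit_def by blast
qed

text \<open>
  A linear map is controlled by its values on an orthonormal basis. The finitely many basis vectors
  of the subspace have bounded orbits, and the sum of their bounds serves for all its points.
\<close>

lemma bounded_orbit_uniform:
  fixes \<F> :: "('a::euclidean_space \<Rightarrow> 'a) set"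
  assumes lin: "\<And>F. F \<in> \<F> \<Longrightarrow> linear F"
  shows "\<exists>C\<ge>0. \<forall>x\<in>bounded_orbit \<F>. \<forall>p\<in>lists \<F>. norm (run p x) \<le> C * norm x"
proof -
  obtain B where B: "B \<subseteq> bounded_orbit \<F>" "pairwise orthogonal B" "\<And>b. b \<in> B \<Longrightarrow> norm b = 1"
      "independent B" "span B = bounded_orbit \<F>"
    using orthonormal_basis_subspace[OF subspace_bounded_orbit[OF lin]] by metis
  have fin: "finite B" using B(4) by (rule independent_imp_finite)
  have "\<forall>b\<in>B. \<exists>M. \<forall>p\<in>lists \<F>. norm (run p b) \<le> M"
    using B(1) unfolding bounded_orbit_def by blast
  then obtain M where M: "\<And>b p. b \<in> B \<Longrightarrow> p \<in> lists \<F> \<Longrightarrow> norm (run p b) \<le> M b"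
    by metis
  have M0: "0 \<le> M b" if "b \<in> B" for b
    using M[OF that, of "[]"] norm_ge_zero[of b] by (simp del: norm_ge_zero)
  have "norm (run p x) \<le> sum M B * norm x" if x: "x \<in> bounded_orbit \<F>" and p: "p \<in> lists \<F>" for x p
  proof -
    have r: "linear (run p)" using linear_run[of \<F>] lin p by blast
    have "x = (\<Sum>b\<in>B. (x \<bullet> b) *\<^sub>R b)"
      using orthonormal_basis_expand[of B x] B x fin by simp
    then have "run p x = run p (\<Sum>b\<in>B. (x \<bullet> b) *\<^sub>R b)" by simp
    also have "\<dots> = (\<Sum>b\<in>B. (x \<bullet> b) *\<^sub>R run p b)"
      by (simp add: linear_sum[OF r] linear_scale[OF r])
    finally have "norm (run p x) \<le> (\<Sum>b\<in>B. \<bar>x \<bullet> b\<bar> * norm (run p b))"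
      by (metis (mono_tags, lifting) norm_scaleR norm_sum sum.cong)
    also have "\<dots> \<le> (\<Sum>b\<in>B. norm x * M b)"
    proof (intro sum_mono mult_mono)
      fix b assume b: "b \<in> B"
      show "\<bar>x \<bullet> b\<bar> \<le> norm x" using Cauchy_Schwarz_ineq2[of x b] B(3)[OF b] by simp
      show "norm (run p b) \<le> M b" using M[OF b p] .
    qed auto
    finally show ?thesis by (simp add: sum_distrib_left mult.commute)
  qed
  then show ?thesis using M0 by (intro exI[of _ "sum M B"]) (auto intro: sum_nonneg)
qed

text \<open>
  If the orbit of \<open>y\<close> outside the subspace were bounded by \<open>N\<close>, then a trajectory entering the
  subspace would enter it at a point of norm at most \<open>c N\<close>, after which \<open>bounded_orbit_uniform\<close>
  bounds it; so the whole orbit of \<open>y\<close> would be bounded.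
\<close>

lemma escape_outside_bounded_orbit:
  fixes \<F> :: "('a::euclidean_space \<Rightarrow> 'a) set"
  assumes lin: "\<And>F. F \<in> \<F> \<Longrightarrow> linear F"
    and bound: "\<And>F x. F \<in> \<F> \<Longrightarrow> norm (F x) \<le> c * norm x"
    and y: "y \<notin> bounded_orbit \<F>"
  shows "\<exists>p\<in>lists \<F>. run p y \<notin> bounded_orbit \<F> \<and> N < norm (run p y)"
proof (rule ccontr)
  let ?B = "bounded_orbit \<F>"
  assume "\<not> ?thesis"
  then have small: "norm (run p y) \<le> N" if "p \<in> lists \<F>" "run p y \<notin> ?B" for p
    using that by (meson not_le_imp_less)
  obtain C where C: "C \<ge> 0" "\<And>x p. x \<in> ?B \<Longrightarrow> p \<in> lists \<F> \<Longrightarrow> norm (run p x) \<le> C * norm x"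
    using bounded_orbit_uniform[of \<F>] lin by metis
  \<comment> \<open>\<open>z\<close> is the first point in \<open>?B\<close> on the way to \<open>run p y\<close>, and \<open>q\<close> the rest of the way.\<close>
  have "run p y \<notin> ?B \<or> (\<exists>z\<in>?B. \<exists>q\<in>lists \<F>. norm z \<le> \<bar>c\<bar> * N \<and> run p y = run q z)"
    if "p \<in> lists \<F>" for p
    using that
  proof (induction p rule: rev_induct)
    case Nil
    then show ?case using y by simp
  next
    case (snoc F p)
    then have F: "F \<in> \<F>" and p: "p \<in> lists \<F>" by auto
    consider "run p y \<notin> ?B" | z q where "z \<in> ?B" "q \<in> lists \<F>" "norm z \<le> \<bar>c\<bar> * N" "run p y = run q z"
      using snoc.IH p by blast
    then show ?case
    proof cases
      case 1
      have "norm (F (run p y)) \<le> c * norm (run p y)" by (rule bound[OF F])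
      also have "\<dots> \<le> \<bar>c\<bar> * N" using small[OF p 1] by (intro mult_mono) auto
      finally show ?thesis
        by (cases "F (run p y) \<in> ?B") (auto intro!: bexI[of _ "F (run p y)"] bexI[of _ "[]"])
    next
      case 2
      then show ?thesis using F
        by (intro disjI2 bexI[of _ z] bexI[of _ "q @ [F]"]) auto
    qed
  qed
  then have "norm (run p y) \<le> max N (C * (\<bar>c\<bar> * N))" if "p \<in> lists \<F>" for p
    using small[OF that] C that by (smt (verit, best) mult_left_mono)
  then have "y \<in> ?B" unfolding bounded_orbit_def by blast
  then show False using y by simp
qed

text \<open>
  Pointwise bounded trajectories are uniformly bounded, in contrapositive form: escaping again and
  again yields longer and longer words, each a prefix of the next, and their limit is the infinite
  sequence of switches.
\<close>

lemma unbounded_trajectory: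
  fixes \<F> :: "('a::euclidean_space \<Rightarrow> 'a) set"
  assumes lin: "\<And>F. F \<in> \<F> \<Longrightarrow> linear F"
    and bound: "\<And>F x. F \<in> \<F> \<Longrightarrow> norm (F x) \<le> c * norm x"
    and y: "y \<notin> bounded_orbit \<F>"
  shows "\<exists>F. (\<forall>k. F k \<in> \<F>) \<and> \<not> Bseq (\<lambda>k. run (map F [0..<k]) y)"
proof -
  let ?good = "\<lambda>p. p \<in> lists \<F> \<and> run p y \<notin> bounded_orbit \<F>"
  have step: "\<exists>q. ?good (p @ q) \<and> q \<noteq> [] \<and> N < norm (run (p @ q) y)" if good: "?good p" for p and N :: real
  proof -
    have "\<exists>q\<in>lists \<F>. run q (run p y) \<notin> bounded_orbit \<F> \<and>
        max N (norm (run p y)) < norm (run q (run p y))"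
      using good by (intro escape_outside_bounded_orbit[where c = c] lin bound) simp_all
    then obtain q where q: "q \<in> lists \<F>" "run q (run p y) \<notin> bounded_orbit \<F>"
        "max N (norm (run p y)) < norm (run q (run p y))"
      by blast
    \<comment> \<open>The escape to a norm above the present one takes at least one step, so the words get longer.\<close>
    have "q \<noteq> []" using q(3) by auto
    then show ?thesis using q good by (intro exI[of _ q]) auto
  qed
  have "\<exists>P. \<forall>j. (?good (P j) \<and> length (P j) \<ge> j) \<and> 
          (\<exists>q. P (Suc j) = P j @ q \<and> real j < norm (run (P (Suc j)) y))"
  proof (rule dependent_nat_choice)
    show "\<exists>p. ?good p \<and> length p \<ge> 0" using y by (intro exI[of _ "[]"]) auto
    fix p j assume p: "?good p \<and> length p \<ge> j"
    then obtain q where "?good (p @ q)" "q \<noteq> []" "real j < norm (run (p @ q) y)"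
      using step[of p "real j"] by blast
    moreover from this p have "length (p @ q) \<ge> Suc j" by (cases q) auto
    ultimately show "\<exists>p'. (?good p' \<and> length p' \<ge> Suc j) \<and> 
        (\<exists>q. p' = p @ q \<and> real j < norm (run p' y))" by blast
  qed
  then obtain P where P: "\<And>j. P j \<in> lists \<F>" "\<And>j. length (P j) \<ge> j"
      "\<And>j. \<exists>q. P (Suc j) = P j @ q" "\<And>j. real j < norm (run (P (Suc j)) y)"
    by metis
  have ext: "\<exists>q. P (i + d) = P i @ q" for i d
  proof (induction d)
    case (Suc d)
    then show ?case using P(3)[of "i + d"] by auto
  qed auto
  define F where "F k = P (Suc k) ! k" for k
  have nth: "P j ! k = F k" if "k < length (P j)" for j k
  proof (cases "j \<le> Suc k")
    case True
    then obtain q where "P (Suc k) = P j @ q" using ext[of j "Suc k - j"] by auto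
    then show ?thesis using that by (simp add: F_def nth_append)
  next
    case False
    then obtain q where "P j = P (Suc k) @ q" using ext[of "Suc k" "j - Suc k"] by auto
    then show ?thesis using P(2)[of "Suc k"] by (simp add: F_def nth_append)
  qed
  have "F k \<in> \<F>" for k
    using P(1)[of "Suc k"] P(2)[of "Suc k"] nth_mem[of k "P (Suc k)"] by (auto simp: F_def in_lists_conv_set)
  moreover have "\<not> Bseq (\<lambda>k. run (map F [0..<k]) y)"
  proof
    assume "Bseq (\<lambda>k. run (map F [0..<k]) y)"
    then obtain M where M: "\<And>k. norm (run (map F [0..<k]) y) \<le> M"
      unfolding Bseq_def by auto
    obtain j where j: "M < real j" using reals_Archimedean2 by blast
    have "map F [0..<length (P (Suc j))] = P (Suc j)"
      by (rule nth_equalityI) (auto simp: nth)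
    then show False using M[of "length (P (Suc j))"] P(4)[of j] j by simp
  qed
  ultimately show ?thesis by blast
qed

section \<open>The orbit norm\<close>

definition orbit_norm :: "('a \<Rightarrow> 'a::real_normed_vector) set \<Rightarrow> 'a \<Rightarrow> real" where
  "orbit_norm \<F> x = (SUP p\<in>lists \<F>. norm (run p x))"

lemma orbit_norm_upper:
  assumes "bounded_orbit \<F> = UNIV" "p \<in> lists \<F>"
  shows "norm (run p x) \<le> orbit_norm \<F> x"
  unfolding orbit_norm_def
proof (rule cSUP_upper[OF assms(2)])
  have "x \<in> bounded_orbit \<F>" using assms(1) by simp
  then show "bdd_above ((\<lambda>p. norm (run p x)) ` lists \<F>)"
    unfolding bounded_orbit_def bdd_above_def by auto
qed

lemma orbit_norm_least:
  assumes "\<And>p. p \<in> lists \<F> \<Longrightarrow> norm (run p x) \<le> M"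
  shows "orbit_norm \<F> x \<le> M"
  unfolding orbit_norm_def by (rule cSUP_least) (use assms in \<open>auto intro: exI[of _ "[]"]\<close>)

lemma orbit_norm_step:
  assumes "bounded_orbit \<F> = UNIV" "F \<in> \<F>"
  shows "orbit_norm \<F> (F x) \<le> orbit_norm \<F> x"
  using orbit_norm_upper[OF assms(1), of "F # _" x] assms(2) by (intro orbit_norm_least) auto

lemma orbit_norm_triangle:
  assumes "bounded_orbit \<F> = UNIV" and lin: "\<And>F. F \<in> \<F> \<Longrightarrow> linear F"
  shows "orbit_norm \<F> (x + y) \<le> orbit_norm \<F> x + orbit_norm \<F> y"
proof (rule orbit_norm_least)
  fix p assume p: "p \<in> lists \<F>"
  have "linear (run p)" using linear_run[of \<F>] lin p by blast
  then show "norm (run p (x + y)) \<le> orbit_norm \<F> x + orbit_norm \<F> y"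
    using orbit_norm_upper[OF assms(1) p] by (simp add: linear_add norm_triangle_mono)
qed

lemma orbit_norm_scaleR_le:
  assumes "bounded_orbit \<F> = UNIV" and lin: "\<And>F. F \<in> \<F> \<Longrightarrow> linear F"
  shows "orbit_norm \<F> (c *\<^sub>R x) \<le> \<bar>c\<bar> * orbit_norm \<F> x"
proof (rule orbit_norm_least)
  fix p assume p: "p \<in> lists \<F>"
  have "linear (run p)" using linear_run[of \<F>] lin p by blast
  then show "norm (run p (c *\<^sub>R x)) \<le> \<bar>c\<bar> * orbit_norm \<F> x"
    using orbit_norm_upper[OF assms(1) p] by (simp add: linear_scale mult_left_mono)
qed

lemma convex_on_orbit_norm:
  assumes "bounded_orbit \<F> = UNIV" and lin: "\<And>F. F \<in> \<F> \<Longrightarrow> linear F"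
  shows "convex_on UNIV (orbit_norm \<F>)"
proof (rule convex_onI)
  fix t x y assume t: "0 < t" "t < (1::real)"
  show "orbit_norm \<F> ((1 - t) *\<^sub>R x + t *\<^sub>R y) \<le> (1 - t) * orbit_norm \<F> x + t * orbit_norm \<F> y"
    using orbit_norm_triangle[of \<F> "(1 - t) *\<^sub>R x" "t *\<^sub>R y"] t
      orbit_norm_scaleR_le[of \<F> "1 - t" x] orbit_norm_scaleR_le[of \<F> t y] assms by fastforce
qed auto

lemma positive_definite_orbit_norm:
  assumes "bounded_orbit \<F> = UNIV" and lin: "\<And>F. F \<in> \<F> \<Longrightarrow> linear F"
  shows "positive_definite_fun (orbit_norm \<F>)"
proof -
  have le: "norm x \<le> orbit_norm \<F> x" for x
    using orbit_norm_upper[OF assms(1), of "[]" x] by simp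
  have "orbit_norm \<F> 0 = 0"
    using orbit_norm_scaleR_le[of \<F> 0 0] le[of 0] assms by fastforce
  moreover have "0 < orbit_norm \<F> x" if "x \<noteq> 0" for x
    using le[of x] that by (metis less_le_trans zero_less_norm_iff)
  ultimately show ?thesis by (simp add: positive_definite_fun_def)
qed

section \<open>The discrete-time inclusion\<close>

lemma norm_mixture_le:
  fixes A :: "'a::finite \<Rightarrow> real ^ 'b ^ 'b"
  assumes "w \<in> weight_simplex"
  shows "norm (mixture A w *v x) \<le> (\<Sum>i\<in>UNIV. onorm ((*v) (A i))) * norm x"
proof -
  have w: "0 \<le> w $ i" "w $ i \<le> 1" for i
  proof -
    show "0 \<le> w $ i" using assms by (simp add: weight_simplex_def)
    have "w $ i \<le> (\<Sum>i\<in>UNIV. w $ i)"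
      using assms by (intro member_le_sum) (auto simp: weight_simplex_def)
    then show "w $ i \<le> 1" using assms by (simp add: weight_simplex_def)
  qed
  have sum_mult: "sum f S *v x = (\<Sum>i\<in>S. f i *v x)" for f :: "'a \<Rightarrow> real ^ 'b ^ 'b" and S
    by (induction S rule: infinite_finite_induct) (auto simp: matrix_vector_mult_add_rdistrib)
  have "mixture A w *v x = (\<Sum>i\<in>UNIV. w $ i *\<^sub>R (A i *v x))"
    unfolding mixture_def sum_mult scaleR_matrix_vector_assoc ..
  also have "norm \<dots> \<le> (\<Sum>i\<in>UNIV. onorm ((*v) (A i)) * norm x)"
  proof (rule sum_norm_le)
    fix i
    have "norm (w $ i *\<^sub>R (A i *v x)) \<le> 1 * norm (A i *v x)"
      unfolding norm_scaleR using w[of i] by (intro mult_right_mono) auto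
    also have "\<dots> \<le> onorm ((*v) (A i)) * norm x"
      using onorm[OF matrix_vector_mul_bounded_linear[of "A i"]] by simp
    finally show "norm (w $ i *\<^sub>R (A i *v x)) \<le> onorm ((*v) (A i)) * norm x" .
  qed
  finally show ?thesis by (simp add: sum_distrib_right)
qed

lemma weak_convex_Lyapunov_discrete_exists:
  fixes A :: "'m::finite \<Rightarrow> real ^ 'n ^ 'n"
  assumes conv: "weakly_convergent_discrete A"
  shows "\<exists>V. weak_convex_Lyapunov_discrete A V"
proof -
  let ?\<F> = "(\<lambda>w. (*v) (mixture A w)) ` weight_simplex"
  have lin: "linear F" if "F \<in> ?\<F>" for F
    using that by auto
  have all: "bounded_orbit ?\<F> = UNIV"
  proof (rule ccontr)
    assume "bounded_orbit ?\<F> \<noteq> UNIV"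
    then obtain y where y: "y \<notin> bounded_orbit ?\<F>" by blast
    have "\<exists>F. (\<forall>k. F k \<in> ?\<F>) \<and> \<not> Bseq (\<lambda>k. run (map F [0..<k]) y)"
      using lin norm_mixture_le by (intro unbounded_trajectory[OF _ _ y]) auto
    then obtain F where F: "\<And>k. F k \<in> ?\<F>" and unb: "\<not> Bseq (\<lambda>k. run (map F [0..<k]) y)"
      by blast
    from F have "\<forall>k. \<exists>w. w \<in> weight_simplex \<and> F k = (*v) (mixture A w)" by blast
    then obtain w where w: "\<And>k. w k \<in> weight_simplex" "\<And>k. F k = (*v) (mixture A (w k))"
      by metis
    have "discrete_solution A w (\<lambda>k. run (map F [0..<k]) y)"
      by (simp add: discrete_solution_def w(2))
    then have "convergent (\<lambda>k. run (map F [0..<k]) y)"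
      using conv w(1) unfolding weakly_convergent_discrete_def convergent_def
      by (metis (no_types, lifting) list.simps(8) run_simps(1) upt_0)
    then show False using unb convergent_imp_Bseq by blast
  qed
  have "weak_convex_Lyapunov_discrete A (orbit_norm ?\<F>)"
    unfolding weak_convex_Lyapunov_discrete_def weak_Lyapunov_discrete_def
    using positive_definite_orbit_norm[OF all lin] convex_on_orbit_norm[OF all lin]
      orbit_norm_step[OF all] by auto
  then show ?thesis by blast
qed

section \<open>The flow of a linear differential equation\<close>

text \<open>
  The exponential series \<open>exp (t G) x\<close>. Summing the points \<open>(G ^^ k) x\<close> instead of the powers of \<open>G\<close>
  keeps all limits in the state space.
\<close>

definition flow :: "('a \<Rightarrow> 'a::real_normed_vector) \<Rightarrow> real \<Rightarrow> 'a \<Rightarrow> 'a" where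
  "flow G t x = (\<Sum>k. (t ^ k / fact k) *\<^sub>R (G ^^ k) x)"

lemma norm_funpow_le:
  fixes G :: "'a::real_normed_vector \<Rightarrow> 'a"
  assumes "\<And>x. norm (G x) \<le> K * norm x" "0 \<le> K"
  shows "norm ((G ^^ k) x) \<le> K ^ k * norm x"
proof (induction k)
  case (Suc k)
  have "norm ((G ^^ Suc k) x) \<le> K * norm ((G ^^ k) x)" using assms(1) by simp
  also have "\<dots> \<le> K * (K ^ k * norm x)" using Suc assms(2) by (rule mult_left_mono)
  finally show ?case by (simp add: mult.assoc)
qed simp

lemma flow_term_le:
  fixes G :: "'a::real_normed_vector \<Rightarrow> 'a"
  assumes "\<And>x. norm (G x) \<le> K * norm x" "0 \<le> K"
  shows "norm ((t ^ k / fact k) *\<^sub>R (G ^^ k) x) \<le> (\<bar>t\<bar> * K) ^ k /\<^sub>R fact k * norm x"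
proof -
  have "norm ((t ^ k / fact k) *\<^sub>R (G ^^ k) x) = \<bar>t\<bar> ^ k / fact k * norm ((G ^^ k) x)"
    by (simp add: power_abs)
  also have "\<dots> \<le> \<bar>t\<bar> ^ k / fact k * (K ^ k * norm x)"
    by (intro mult_left_mono norm_funpow_le assms) auto
  finally show ?thesis by (simp add: power_mult_distrib field_simps)
qed

lemma summable_norm_flow:
  fixes G :: "'a::real_normed_vector \<Rightarrow> 'a"
  assumes "bounded_linear G"
  shows "summable (\<lambda>k. norm ((t ^ k / fact k) *\<^sub>R (G ^^ k) x))"
proof (rule summable_comparison_test')
  show "summable (\<lambda>k. (\<bar>t\<bar> * onorm G) ^ k /\<^sub>R fact k * norm x)"
    by (intro summable_mult2 summable_exp_generic)
  show "norm (norm ((t ^ k / fact k) *\<^sub>R (G ^^ k) x)) \<le> (\<bar>t\<bar> * onorm G) ^ k /\<^sub>R fact k * norm x"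
    if "k \<ge> 0" for k
    using flow_term_le[of G "onorm G" t k x] onorm[OF assms] onorm_pos_le[OF assms] by simp
qed

lemma summable_flow:
  fixes G :: "'a::banach \<Rightarrow> 'a"
  assumes "bounded_linear G"
  shows "summable (\<lambda>k. (t ^ k / fact k) *\<^sub>R (G ^^ k) x)"
  using summable_norm_cancel[OF summable_norm_flow[OF assms]] .

lemma flow_0 [simp]: "flow G 0 x = x"
proof -
  have "(\<lambda>k. (0 ^ k / fact k) *\<^sub>R (G ^^ k) x) = (\<lambda>k. if k = 0 then x else 0)"
    by (auto simp: fun_eq_iff)
  then show ?thesis unfolding flow_def using sums_single[of 0 "\<lambda>_. x"] by (simp add: sums_iff)
qed

lemma norm_flow_le:
  fixes G :: "'a::banach \<Rightarrow> 'a"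
  assumes "bounded_linear G" "\<And>x. norm (G x) \<le> K * norm x" "0 \<le> K" "0 \<le> t"
  shows "norm (flow G t x) \<le> exp (K * t) * norm x"
proof -
  have s: "(\<lambda>k. (\<bar>t\<bar> * K) ^ k /\<^sub>R fact k * norm x) sums (exp (\<bar>t\<bar> * K) * norm x)"
    by (intro sums_mult2 exp_converges)
  have "norm (flow G t x) \<le> (\<Sum>k. norm ((t ^ k / fact k) *\<^sub>R (G ^^ k) x))"
    unfolding flow_def by (rule summable_norm[OF summable_norm_flow[OF assms(1)]])
  also have "\<dots> \<le> (\<Sum>k. (\<bar>t\<bar> * K) ^ k /\<^sub>R fact k * norm x)"
    using flow_term_le[of G K] assms(2,3) summable_norm_flow[OF assms(1)] sums_summable[OF s]
    by (intro suminf_le) auto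
  also have "\<dots> = exp (K * t) * norm x"
    using s assms(4) by (simp add: sums_iff mult.commute)
  finally show ?thesis .
qed

lemma linear_flow:
  fixes G :: "'a::banach \<Rightarrow> 'a"
  assumes "bounded_linear G"
  shows "linear (flow G t)"
proof (rule linearI)
  have lin: "linear (G ^^ k)" for k
  proof (induction k)
    case 0
    then show ?case using linear_id by (metis funpow_0 eq_id_iff)
  next
    case (Suc k)
    then show ?case using linear_compose[OF Suc bounded_linear.linear[OF assms]] by (simp add: comp_def)
  qed
  note s = summable_flow[OF assms]
  show "flow G t (x + y) = flow G t x + flow G t y" for x y
    unfolding flow_def suminf_add[OF s s]
    by (simp add: linear_add[OF lin] scaleR_add_right)
  show "flow G t (c *\<^sub>R x) = c *\<^sub>R flow G t x" for c x
    unfolding flow_def suminf_scaleR_right[OF s]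
    by (simp add: linear_scale[OF lin] mult.commute)
qed

text \<open>
  Every coordinate of the flow is a real power series in \<open>t\<close>, which can be differentiated term by
  term; the coefficients of the derivative are those of the same coordinate of \<open>G\<close> applied to the
  flow.
\<close>

lemma flow_has_vector_derivative:
  fixes G :: "'a::euclidean_space \<Rightarrow> 'a"
  assumes "bounded_linear G"
  shows "((\<lambda>t. flow G t x) has_vector_derivative G (flow G t x)) (at t within S)"
  unfolding has_vector_derivative_def
proof (subst has_derivative_componentwise_within, rule ballI)
  fix i :: 'a
  assume "i \<in> Basis"
  define c where "c k = ((G ^^ k) x \<bullet> i) / fact k" for k
  have comp: "flow G s x \<bullet> i = (\<Sum>k. c k * s ^ k)" for s
    unfolding flow_def bounded_linear.suminf[OF bounded_linear_inner_left summable_flow[OF assms]]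
    by (simp add: c_def mult.commute)
  have dcomp: "G (flow G s x) \<bullet> i = (\<Sum>k. diffs c k * s ^ k)" for s
  proof -
    have "bounded_linear (\<lambda>y. G y \<bullet> i)"
      by (intro bounded_linear_compose[OF bounded_linear_inner_left assms])
    from bounded_linear.suminf[OF this summable_flow[OF assms]]
    have "G (flow G s x) \<bullet> i = (\<Sum>k. G ((s ^ k / fact k) *\<^sub>R (G ^^ k) x) \<bullet> i)"
      unfolding flow_def .
    also have "\<dots> = (\<Sum>k. diffs c k * s ^ k)"
      by (intro suminf_cong)
        (simp add: c_def diffs_def linear_scale[OF bounded_linear.linear[OF assms]] del: of_nat_Suc)
    finally show ?thesis .
  qed
  have "summable (\<lambda>k. c k * s ^ k)" for s
    using bounded_linear.summable[OF bounded_linear_inner_left[of i] summable_flow[OF assms, of s x]]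
    by (simp add: c_def mult.commute)
  then have "((\<lambda>s. flow G s x \<bullet> i) has_field_derivative G (flow G t x) \<bullet> i) (at t)"
    unfolding comp dcomp by (rule termdiffs_strong_converges_everywhere)
  then show "((\<lambda>s. flow G s x \<bullet> i) has_derivative (\<lambda>h. (h *\<^sub>R G (flow G t x)) \<bullet> i)) (at t within S)"
    using has_derivative_at_withinI
    unfolding has_real_derivative_iff_has_vector_derivative has_vector_derivative_def inner_scaleR_left
      real_scaleR_def by blast
qed

lemma flow_lipschitz:
  fixes G :: "'a::euclidean_space \<Rightarrow> 'a"
  assumes "bounded_linear G"
  shows "\<exists>L. L-lipschitz_on {0..b} (\<lambda>t. flow G t x)"
proof -
  let ?K = "onorm G"
  let ?L = "?K * (exp (?K * b) * norm x)"
  have K: "0 \<le> ?K" "norm (G y) \<le> ?K * norm y" for y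
    using onorm[OF assms] onorm_pos_le[OF assms] by auto
  have "?L-lipschitz_on {0..b} (\<lambda>t. flow G t x)"
  proof (rule bounded_derivative_imp_lipschitz)
    show "((\<lambda>t. flow G t x) has_derivative (\<lambda>h. h *\<^sub>R G (flow G t x))) (at t within {0..b})" for t
      using flow_has_vector_derivative[OF assms] unfolding has_vector_derivative_def .
    fix t assume t: "t \<in> {0..b}"
    have "norm (G (flow G t x)) \<le> ?K * norm (flow G t x)" by (rule K)
    also have "\<dots> \<le> ?K * (exp (?K * t) * norm x)"
      using K t by (intro mult_left_mono norm_flow_le assms) auto
    also have "\<dots> \<le> ?L"
      using K t by (intro mult_left_mono mult_right_mono) (auto intro: mult_left_mono)
    finally show "onorm (\<lambda>h. h *\<^sub>R G (flow G t x)) \<le> ?L"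
      by (simp add: onorm_scaleR_left[OF bounded_linear_ident] onorm_id)
  qed (use K in auto)
  then show ?thesis by blast
qed

section \<open>Piecewise constant switching in continuous time\<close>

lemma lipschitz_imp_absolutely_continuous:
  assumes "L-lipschitz_on {a..b} f"
  shows "absolutely_continuous_fun a b f"
  unfolding absolutely_continuous_fun_def
proof (intro allI impI)
  fix \<epsilon> :: real assume "\<epsilon> > 0"
  have L: "0 \<le> L" using assms by (rule lipschitz_on_nonneg)
  show "\<exists>\<delta>>0. \<forall>D. D division_of \<Union>D \<longrightarrow> \<Union>D \<subseteq> {a..b} \<longrightarrow>
      (\<Sum>K\<in>D. Sup K - Inf K) < \<delta> \<longrightarrow> (\<Sum>K\<in>D. norm (f (Sup K) - f (Inf K))) < \<epsilon>"
  proof (intro exI[of _ "\<epsilon> / (L + 1)"] conjI allI impI)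
    show "0 < \<epsilon> / (L + 1)" using \<open>\<epsilon> > 0\<close> L by simp
    fix D assume D: "D division_of \<Union>D" "\<Union>D \<subseteq> {a..b}" "(\<Sum>K\<in>D. Sup K - Inf K) < \<epsilon> / (L + 1)"
    have le: "norm (f (Sup K) - f (Inf K)) \<le> (L + 1) * (Sup K - Inf K)" if K_in: "K \<in> D" for K
    proof -
      obtain u v where K: "K = cbox u v" using division_ofD(4)[OF D(1) K_in] by blast
      then have uv: "K = {u..v}" "u \<le> v" using division_ofD(3)[OF D(1) K_in] by auto
      have "K \<subseteq> {a..b}" using D(2) K_in by blast
      then have "dist (f v) (f u) \<le> L * dist v u"
        using uv by (intro lipschitz_onD[OF assms]) auto
      also have "\<dots> \<le> (L + 1) * dist v u" by (intro mult_right_mono) auto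
      finally show ?thesis using uv by (simp add: dist_norm)
    qed
    have "(\<Sum>K\<in>D. norm (f (Sup K) - f (Inf K))) \<le> (\<Sum>K\<in>D. (L + 1) * (Sup K - Inf K))"
      by (rule sum_mono) (rule le)
    also have "\<dots> = (L + 1) * (\<Sum>K\<in>D. Sup K - Inf K)" by (simp add: sum_distrib_left)
    also have "\<dots> < \<epsilon>" using D(3) L by (simp add: field_simps)
    finally show "(\<Sum>K\<in>D. norm (f (Sup K) - f (Inf K))) < \<epsilon>" .
  qed
qed

text \<open>
  The index of the switching interval \<open>{T k..<T (Suc k)}\<close> that contains \<open>s\<close>; for increasing \<open>T\<close>,
  times before \<open>T 0\<close> get the index 0.
\<close>

definition piece :: "(nat \<Rightarrow> real) \<Rightarrow> real \<Rightarrow> nat" where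
  "piece T s = (LEAST k. s < T (Suc k))"

lemma piece_eq:
  assumes "strict_mono T" "T k \<le> s" "s < T (Suc k)"
  shows "piece T s = k"
  unfolding piece_def
proof (rule Least_equality)
  fix j assume "s < T (Suc j)"
  then have "T k < T (Suc j)" using assms(2) by simp
  then show "k \<le> j" using strict_mono_less[OF assms(1)] by (metis less_Suc_eq_le)
qed (use assms in auto)

lemma piece_bounds:
  assumes "filterlim T at_top sequentially" "T 0 \<le> s"
  shows "T (piece T s) \<le> s" "s < T (Suc (piece T s))"
proof -
  have "eventually (\<lambda>k. s < T k) sequentially"
    using assms(1) by (auto simp: filterlim_at_top_dense)
  then have ex: "\<exists>k. s < T (Suc k)"
    by (metis eventually_sequentially le_Suc_eq order_refl)
  then show "s < T (Suc (piece T s))" unfolding piece_def by (rule LeastI_ex)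
  show "T (piece T s) \<le> s"
  proof (cases "piece T s")
    case 0
    then show ?thesis using assms(2) by simp
  next
    case (Suc j)
    then have "\<not> s < T (Suc j)" unfolding piece_def by (metis lessI not_less_Least)
    then show ?thesis using Suc by simp
  qed
qed

lemma measurable_piece:
  assumes "strict_mono T" "filterlim T at_top sequentially" "T 0 = 0"
  shows "piece T \<in> measurable (lebesgue_on {0..}) (count_space UNIV)"
proof (subst measurable_count_space_eq_countable, simp, intro conjI ballI)
  fix k
  have "piece T -` {k} \<inter> space (lebesgue_on {0..}) = {T k..<T (Suc k)}"
  proof -
    have "0 \<le> T k" using assms(1,3) strict_mono_less_eq[of T 0 k] by simp
    then show ?thesis
      using piece_eq[OF assms(1)] piece_bounds[OF assms(2)] assms(3) by fastforce
  qed
  moreover have "{T k..<T (Suc k)} \<in> sets (lebesgue_on {0..})"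
    using assms(1,3) strict_mono_less_eq[of T 0 k] by (subst sets_restrict_space_iff) auto
  ultimately show "piece T -` {k} \<inter> space (lebesgue_on {0..}) \<in> sets (lebesgue_on {0..})" by simp
qed auto

text \<open>
  Gluing flows end to end gives a curve that is Lipschitz on each bounded interval, hence absolutely
  continuous there, and that solves the equation except at the countably many switching times.
\<close>

lemma piecewise_flow_solution:
  fixes A :: "'m::finite \<Rightarrow> real ^ 'n ^ 'n" and w :: "nat \<Rightarrow> real ^ 'm"
  defines "G \<equiv> \<lambda>k. (*v) (mixture A (w k))"
  assumes T: "strict_mono T" "filterlim T at_top sequentially" "T 0 = 0"
    and y: "\<And>k. y (Suc k) = flow (G k) (T (Suc k) - T k) (y k)"
  shows "\<exists>x. continuous_solution A (w \<circ> piece T) x \<and> (\<forall>k. x (T k) = y k)"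
proof -
  have G: "bounded_linear (G k)" for k
    unfolding G_def by (rule matrix_vector_mul_bounded_linear)
  define x where "x s = flow (G (piece T s)) (s - T (piece T s)) (y (piece T s))" for s
  have TS: "T k < T (Suc k)" for k using T(1) by (simp add: strict_monoD)
  have x1: "x s = flow (G k) (s - T k) (y k)" if "T k \<le> s" "s < T (Suc k)" for k s
    using piece_eq[OF T(1) that] by (simp add: x_def)
  have xT: "x (T k) = y k" for k using x1[of k "T k"] TS by simp
  \<comment> \<open>The formula extends to the right end point, where the next piece takes over continuously.\<close>
  have x2: "x s = flow (G k) (s - T k) (y k)" if "s \<in> {T k..T (Suc k)}" for k s
    using x1[of k s] that xT[of "Suc k"] y[of k] by (cases "s = T (Suc k)") auto
  have lip: "\<exists>L. L-lipschitz_on {0..T k} x" for k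
  proof (induction k)
    case 0
    then show ?case using T(3) by (auto simp: lipschitz_on_def intro!: exI[of _ 0])
  next
    case (Suc k)
    then obtain L where L: "L-lipschitz_on {0..T k} x" by blast
    obtain M where M: "M-lipschitz_on {0..T (Suc k) - T k} (\<lambda>t. flow (G k) t (y k))"
      using flow_lipschitz[OF G] by blast
    have "M-lipschitz_on {T k..T (Suc k)} x"
    proof (rule lipschitz_onI)
      fix s t assume st: "s \<in> {T k..T (Suc k)}" "t \<in> {T k..T (Suc k)}"
      have "dist (x s) (x t) \<le> M * dist (s - T k) (t - T k)"
        unfolding x2[OF st(1)] x2[OF st(2)] using st by (intro lipschitz_onD[OF M]) auto
      then show "dist (x s) (x t) \<le> M * dist s t" by (simp add: dist_norm)
    qed (rule lipschitz_on_nonneg[OF M])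
    from lipschitz_on_concat_max[OF L this] show ?case by auto
  qed
  have "absolutely_continuous_fun 0 S x" for S
  proof -
    have "eventually (\<lambda>k. S \<le> T k) sequentially" using T(2) by (simp add: filterlim_at_top)
    then obtain k where k: "S \<le> T k" by (auto simp: eventually_sequentially)
    obtain L where L: "L-lipschitz_on {0..T k} x" using lip by blast
    show ?thesis
      by (rule lipschitz_imp_absolutely_continuous[OF lipschitz_on_subset[OF L]]) (use k in auto)
  qed
  moreover have "AE t in lebesgue_on {0..}.
      (x has_vector_derivative mixture A ((w \<circ> piece T) t) *v x t) (at t within {0..})"
  proof -
    have "range T \<in> null_sets lebesgue"
      by (intro null_sets_completionI countable_imp_null_set_lborel) auto
    then have "AE t in lebesgue. t \<notin> range T" by (rule AE_not_in)
    then have "AE t in lebesgue. t \<in> {0..} \<longrightarrow>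
      (x has_vector_derivative mixture A ((w \<circ> piece T) t) *v x t) (at t within {0..})"
    proof (rule AE_mp, intro AE_I2 impI)
      fix t :: real assume t: "t \<notin> range T" "t \<in> {0..}"
      define k where "k = piece T t"
      have "T k \<le> t" "t < T (Suc k)"
        using piece_bounds[OF T(2)] T(3) t(2) by (auto simp: k_def)
      then have k: "t \<in> {T k<..<T (Suc k)}" using t(1) by (cases "T k = t") auto
      have "((\<lambda>s. flow (G k) (s - T k) (y k)) has_vector_derivative
          G k (flow (G k) (t - T k) (y k))) (at t)"
      proof -
        have "((\<lambda>s. s - T k) has_vector_derivative 1) (at t)"
          by (auto intro!: derivative_eq_intros)
        from vector_diff_chain_at[OF this flow_has_vector_derivative[OF G]]
        show ?thesis by (simp add: comp_def)
      qed
      moreover have "x t = flow (G k) (t - T k) (y k)" using x1 k by auto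
      ultimately have "((\<lambda>s. flow (G k) (s - T k) (y k)) has_vector_derivative G k (x t)) (at t)"
        by simp
      then have "(x has_vector_derivative G k (x t)) (at t)"
        by (rule has_vector_derivative_transform_within_open[OF _ open_greaterThanLessThan k])
          (auto intro!: x1[symmetric])
      then show "(x has_vector_derivative mixture A ((w \<circ> piece T) t) *v x t) (at t within {0..})"
        by (simp add: G_def k_def has_vector_derivative_at_within)
    qed
    then show ?thesis by (subst AE_restrict_space_iff) auto
  qed
  ultimately show ?thesis using xT unfolding continuous_solution_def by blast
qed

section \<open>The continuous-time inclusion\<close>

text \<open>
  The Euler step \<open>x + h G x\<close> differs from \<open>flow G h x\<close> by \<open>o(h)\<close>. The orbit norm does not increase
  along the flow, and on the difference it is at most a constant times the norm.
\<close>

lemma Limsup_orbit_norm_le_0: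
  fixes \<F> :: "('a::euclidean_space \<Rightarrow> 'a) set"
  assumes all: "bounded_orbit \<F> = UNIV" and lin: "\<And>F. F \<in> \<F> \<Longrightarrow> linear F"
    and G: "bounded_linear G" and flow: "\<And>h. 0 < h \<Longrightarrow> h \<le> 1 \<Longrightarrow> flow G h \<in> \<F>"
  shows "Limsup (at_right 0)
    (\<lambda>h. ereal ((orbit_norm \<F> (x + h *\<^sub>R G x) - orbit_norm \<F> x) / h)) \<le> 0"
proof -
  let ?V = "orbit_norm \<F>"
  obtain C where C: "0 \<le> C" "\<And>x p. p \<in> lists \<F> \<Longrightarrow> norm (run p x) \<le> C * norm x"
    using bounded_orbit_uniform[of \<F>] lin all by (metis UNIV_I)
  have VC: "?V z \<le> C * norm z" for z by (rule orbit_norm_least) (rule C)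
  define r where "r h = C * (norm (flow G h x - x - h *\<^sub>R G x) / norm h)" for h
  have "((\<lambda>h. flow G h x) has_vector_derivative G x) (at_right 0)"
    using flow_has_vector_derivative[OF G, of x 0] by simp
  then have lim: "(r \<longlongrightarrow> 0) (at_right 0)"
    unfolding r_def has_vector_derivative_def has_derivative_iff_norm
    by (intro tendsto_mult_right_zero) simp
  have "(?V (x + h *\<^sub>R G x) - ?V x) / h \<le> r h" if h: "0 < h" "h \<le> 1" for h
  proof -
    have "?V (x + h *\<^sub>R G x) = ?V (flow G h x + (x + h *\<^sub>R G x - flow G h x))" by simp
    also have "\<dots> \<le> ?V (flow G h x) + ?V (x + h *\<^sub>R G x - flow G h x)"
      by (rule orbit_norm_triangle[OF all lin])
    also have "?V (flow G h x) \<le> ?V x" by (rule orbit_norm_step[OF all flow[OF h]])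
    also have "?V (x + h *\<^sub>R G x - flow G h x) \<le> C * norm (x + h *\<^sub>R G x - flow G h x)"
      by (rule VC)
    also have "C * norm (x + h *\<^sub>R G x - flow G h x) = h * r h"
      using h norm_minus_commute[of "flow G h x" "x + h *\<^sub>R G x"] by (simp add: r_def algebra_simps)
    finally show ?thesis using h by (simp add: field_simps)
  qed
  then have "eventually (\<lambda>h. ereal ((?V (x + h *\<^sub>R G x) - ?V x) / h) \<le> ereal (r h)) (at_right 0)"
    unfolding eventually_at_right_field by (intro exI[of _ 1]) auto
  then have "Limsup (at_right 0) (\<lambda>h. ereal ((?V (x + h *\<^sub>R G x) - ?V x) / h))
      \<le> Limsup (at_right 0) (\<lambda>h. ereal (r h))" by (rule Limsup_mono)
  also have "\<dots> = 0"
    using lim by (intro lim_imp_Limsup) (auto simp: zero_ereal_def)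
  finally show ?thesis .
qed

lemma weak_convex_Lyapunov_continuous_exists:
  fixes A :: "'m::finite \<Rightarrow> real ^ 'n ^ 'n"
  assumes conv: "weakly_convergent_continuous A"
  shows "\<exists>V. weak_convex_Lyapunov_continuous A V"
proof -
  let ?G = "\<lambda>w. (*v) (mixture A w)"
  let ?K = "\<Sum>i\<in>UNIV. onorm ((*v) (A i))"
  \<comment> \<open>Durations up to 1 suffice to follow any flow in steps and make the family bounded; positive
    durations keep the switching times strictly increasing.\<close>
  let ?\<F> = "{flow (?G w) t | w t. w \<in> weight_simplex \<and> 0 < t \<and> t \<le> 1}"
  have G: "bounded_linear (?G w)" for w by (rule matrix_vector_mul_bounded_linear)
  have K: "0 \<le> ?K" by (intro sum_nonneg onorm_pos_le matrix_vector_mul_bounded_linear)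
  have lin: "linear F" if "F \<in> ?\<F>" for F
    using that linear_flow[OF G] by auto
  have growth: "norm (flow (?G w) t x) \<le> exp (?K * t) * norm x"
    if "w \<in> weight_simplex" "0 \<le> t" for w t x
    by (rule norm_flow_le[OF G norm_mixture_le[OF that(1)] K that(2)])
  have bound: "norm (F x) \<le> exp ?K * norm x" if F_in: "F \<in> ?\<F>" for F x
  proof -
    obtain w t where F: "F = flow (?G w) t" "w \<in> weight_simplex" "0 < t" "t \<le> 1"
      using F_in by blast
    have "norm (F x) \<le> exp (?K * t) * norm x" using growth[of w t x] F by simp
    also have "\<dots> \<le> exp ?K * norm x"
      using F K by (intro mult_right_mono) (auto intro: mult_left_le)
    finally show ?thesis .
  qed
  have all: "bounded_orbit ?\<F> = UNIV"
  proof (rule ccontr)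
    assume "bounded_orbit ?\<F> \<noteq> UNIV"
    then obtain x0 where x0: "x0 \<notin> bounded_orbit ?\<F>" by blast
    have "\<exists>F. (\<forall>k. F k \<in> ?\<F>) \<and> \<not> Bseq (\<lambda>k. run (map F [0..<k]) x0)"
      by (rule unbounded_trajectory[where c = "exp ?K", OF _ _ x0]) (fact lin, fact bound)
    then obtain F where F: "\<And>k. F k \<in> ?\<F>" and unb: "\<not> Bseq (\<lambda>k. run (map F [0..<k]) x0)"
      by blast
    define y where "y k = run (map F [0..<k]) x0" for k
    from F have "\<forall>k. \<exists>w t. w \<in> weight_simplex \<and> 0 < t \<and> F k = flow (?G w) t" by blast
    then obtain w t where w: "\<And>k. w k \<in> weight_simplex" and t: "\<And>k. 0 < t k"
        and Fk: "\<And>k. F k = flow (?G (w k)) (t k)"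
      by metis
    define T where "T k = (\<Sum>j<k. t j)" for k
    have T0: "T 0 = 0" and TS: "T (Suc k) = T k + t k" for k by (simp_all add: T_def)
    have mono: "strict_mono T" using t by (intro strict_monoI_Suc) (simp add: TS)
    have y0: "y 0 = x0" and yS: "y (Suc k) = flow (?G (w k)) (t k) (y k)" for k
      by (simp_all add: y_def Fk)
    have y_le: "norm (y k) \<le> exp (?K * T k) * norm x0" for k
    proof (induction k)
      case (Suc k)
      have "norm (y (Suc k)) \<le> exp (?K * t k) * norm (y k)"
        unfolding yS using w t by (intro growth) (auto intro: less_imp_le)
      also have "\<dots> \<le> exp (?K * t k) * (exp (?K * T k) * norm x0)"
        using Suc by (intro mult_left_mono) auto
      finally show ?case by (simp add: TS exp_add algebra_simps)
    qed (simp add: y0 T0)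
    \<comment> \<open>If the switching times stayed below \<open>Z\<close>, the growth bound would make \<open>y\<close> bounded.\<close>
    have lim: "filterlim T at_top sequentially"
      unfolding filterlim_at_top
    proof (rule ccontr)
      assume "\<not> (\<forall>Z. \<forall>\<^sub>F k in sequentially. Z \<le> T k)"
      then obtain Z where Z: "\<And>N. \<exists>k\<ge>N. T k < Z"
        unfolding eventually_sequentially by (meson not_le)
      have "T k \<le> Z" for k
        using Z[of k] strict_mono_less_eq[OF mono] by (meson less_imp_le order_trans)
      then have "norm (y k) \<le> exp (?K * Z) * norm x0" for k
        using K by (intro order_trans[OF y_le] mult_right_mono) (auto intro: mult_left_mono)
      then have "Bseq y" by (rule BseqI')
      then show False using unb by (simp add: y_def[abs_def])
    qed
    obtain x where x: "continuous_solution A (w \<circ> piece T) x" "\<And>k. x (T k) = y k"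
      using piecewise_flow_solution[OF mono lim T0, of y A w] yS by (auto simp: TS)
    have "w \<circ> piece T \<in> borel_measurable (lebesgue_on {0..})"
      by (rule measurable_comp[OF measurable_piece[OF mono lim T0]]) simp
    moreover have "x 0 = x0" using x(2)[of 0] by (simp add: T0 y0)
    ultimately obtain xbar where "(x \<longlongrightarrow> xbar) at_top"
      using conv x(1) w unfolding weakly_convergent_continuous_def by (metis comp_apply)
    then have "(\<lambda>k. x (T k)) \<longlonglongrightarrow> xbar" using lim by (rule filterlim_compose)
    then have "Bseq y" unfolding x(2) by (intro convergent_imp_Bseq) (auto simp: convergent_def)
    then show False using unb by (simp add: y_def[abs_def])
  qed
  have "weak_convex_Lyapunov_continuous A (orbit_norm ?\<F>)"
    unfolding weak_convex_Lyapunov_continuous_def weak_Lyapunov_continuous_def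
  proof (intro conjI allI ballI)
    show "positive_definite_fun (orbit_norm ?\<F>)" by (rule positive_definite_orbit_norm[OF all lin])
    show "convex_on UNIV (orbit_norm ?\<F>)" by (rule convex_on_orbit_norm[OF all lin])
    fix x :: "real ^ 'n" and w :: "real ^ 'm"
    assume w: "w \<in> weight_simplex"
    show "Limsup (at_right 0) (\<lambda>h. ereal ((orbit_norm ?\<F> (x + h *\<^sub>R (mixture A w *v x))
        - orbit_norm ?\<F> x) / h)) \<le> 0"
      by (rule Limsup_orbit_norm_le_0[OF all lin G]) (use w in blast)+
  qed
  then show ?thesis by blast
qed

theorem theorem4:
  fixes A :: "'m::finite \<Rightarrow> real ^ 'n ^ 'n"
  shows "(weakly_convergent_discrete A \<longrightarrow> (\<exists>V. weak_convex_Lyapunov_discrete A V)) \<and>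
    (weakly_convergent_continuous A \<longrightarrow> (\<exists>V. weak_convex_Lyapunov_continuous A V))"
  using weak_convex_Lyapunov_discrete_exists weak_convex_Lyapunov_continuous_exists by blast

end
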